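(* Let $\mathcal P=\prod_{s=1}^{\ell}[\underline\rho_s,\overline\rho_s]\subset\mathbb R^\ell$ be partitioned into the grid cells $\mathcal H_{\mathbf c}$ described in the context. Let $\bm y=(y_1,\dots,y_N)^\top:\mathcal P\to\mathbb R^N$ be Lipschitz continuous on $\mathcal P$ and polynomial on each cell $\mathcal H_{\mathbf c}$. Let $T_{i,s},F_0,F_i:\mathcal P\to\mathbb S^n$ ($i=1,\dots,N$, $s=1,\dots,\ell$) be symmetric-matrix-valued functions that are continuous on $\mathcal P$ and polynomial on each cell. For an interface point $\bar{\bm\rho}$ and a cell index $\mathbf c\in\mathcal A(\bar{\bm\rho})$ define the limiting Jacobian $$G_{\mathbf c}=G_{\mathbf c}(\bar{\bm\rho}):=\left[\lim_{\substack{\bm\rho\to\bar{\bm\rho}\\ \bm\rho\in\operatorname{int}(\mathcal H_{\mathbf c})}}\frac{\partial y_i}{\partial\rho_s}(\bm\rho)\right]_{i=1,\dots,N;\ s=1,\dots,\ell}\in\mathbb R^{N\times\ell}.$$ Then, at every interface point $\bar{\bm\rho}$, the relative Clarke generalized Jacobian satisfies $$\partial^\circ_{\mathcal P}\bm y(\bar{\bm\rho})\subseteq\operatorname{co}\{G_{\mathbf c}:\mathbf c\in\mathcal A(\bar{\bm\rho})\}.$$ Moreover, suppose that for all interface points $\bar{\bm\rho}$ the inequality $$\sum_{i=1}^{N}\sum_{s=1}^{\ell}T_{i,s}(\bar{\bm\rho})(G_{\mathbf c})_{i,s}+F_0(\bar{\bm\rho})+\sum_{i=1}^{N}F_i(\bar{\bm\rho})\,y_i(\bar{\bm\rho})\preceq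 0$$ holds for every $\mathbf c\in\mathcal A(\bar{\bm\rho})$. Then for every interface point $\bar{\bm\rho}$ and every $G\in\partial^\circ_{\mathcal P}\bm y(\bar{\bm\rho})$, $$\sum_{i=1}^{N}\sum_{s=1}^{\ell}T_{i,s}(\bar{\bm\rho})\,G_{i,s}+F_0(\bar{\bm\rho})+\sum_{i=1}^{N}F_i(\bar{\bm\rho})\,y_i(\bar{\bm\rho})\preceq 0.$$
   Context: Grid and cells: for each $s=1,\dots,\ell$ fix grid nodes $\underline\rho_s=\rho_s^{(1)}<\cdots<\rho_s^{(k_s)}=\overline\rho_s$ with $k_s\ge 2$. For $\mathbf c=(c_1,\dots,c_\ell)$ with $c_s\in\{1,\dots,k_s-1\}$, the (closed) cell is $\mathcal H_{\mathbf c}=\prod_{s=1}^{\ell}[\rho_s^{(c_s)},\rho_s^{(c_s+1)}]$. A point $\bar{\bm\rho}\in\mathcal P$ is an interface point if it belongs to more than one cell, and $\mathcal A(\bar{\bm\rho})$ denotes the set of indices $\mathbf c$ of the cells adjacent to it, i.e. with $\bar{\bm\rho}\in\mathcal H_{\mathbf c}$. Relative Clarke generalized Jacobian: let $f:\mathcal P\to\mathbb R^q$ be continuous, with the restriction of $f$ to each cell extending to a $C^1$ map on a neighborhood of that (closed) cell. Then $$\partial^\circ_{\mathcal P}f(\bar{\bm\rho}):=\operatorname{co}\left\{\lim_{\substack{\bm\rho\to\bar{\bm\rho}\\ \bm\rho\in\operatorname{int}_{\mathcal P}(\mathcal H_{\mathbf c})}}Jf(\bm\rho)\ \middle|\ \mathbf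 c\in\mathcal A(\bar{\bm\rho})\right\},$$ where $Jf=[\partial f_a/\partial\rho_s]_{a,s}\in\mathbb R^{q\times\ell}$ is the ordinary Jacobian (one-sided, i.e. that of the $C^1$ extension of the cell restriction, at points on the exterior boundary of $\mathcal P$), and $\operatorname{int}_{\mathcal P}$ is the interior relative to $\mathcal P$. $\operatorname{co}$ denotes the convex hull, $\mathbb S^n$ the real symmetric $n\times n$ matrices, and $X\preceq 0$ means that $X$ is negative semidefinite. *)

theory Defs
  imports "HOL-Analysis.Analysis"
begin

text \<open>Points of \<open>\<real>\<^sup>\<ell>\<close> have type \<^typ>\<open>real^'l\<close>. The nodes along coordinate \<open>s\<close> are
  \<open>r s 1 < \<dots> < r s (k s)\<close>; values of \<open>r s\<close> outside \<open>{1..k s}\<close> are irrelevant.\<close>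

definition grid :: "('l::finite \<Rightarrow> nat) \<Rightarrow> ('l \<Rightarrow> nat \<Rightarrow> real) \<Rightarrow> bool" where
  "grid k r \<longleftrightarrow> (\<forall>s. 2 \<le> k s \<and> strict_mono_on {1..k s} (r s))"

definition param_box :: "('l::finite \<Rightarrow> nat) \<Rightarrow> ('l \<Rightarrow> nat \<Rightarrow> real) \<Rightarrow> (real^'l) set" where
  "param_box k r = cbox (\<chi> s. r s 1) (\<chi> s. r s (k s))"

definition cell_indices :: "('l::finite \<Rightarrow> nat) \<Rightarrow> ('l \<Rightarrow> nat) set" where
  "cell_indices k = {c. \<forall>s. c s \<in> {1..k s - 1}}"

definition cell :: "('l::finite \<Rightarrow> nat \<Rightarrow> real) \<Rightarrow> ('l \<Rightarrow> nat) \<Rightarrow> (real^'l) set" where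
  "cell r c = cbox (\<chi> s. r s (c s)) (\<chi> s. r s (c s + 1))"

definition adjacent_cells ::
    "('l::finite \<Rightarrow> nat) \<Rightarrow> ('l \<Rightarrow> nat \<Rightarrow> real) \<Rightarrow> real^'l \<Rightarrow> ('l \<Rightarrow> nat) set" where
  "adjacent_cells k r x = {c \<in> cell_indices k. x \<in> cell r c}"

definition interface_points ::
    "('l::finite \<Rightarrow> nat) \<Rightarrow> ('l \<Rightarrow> nat \<Rightarrow> real) \<Rightarrow> (real^'l) set" where
  "interface_points k r = {x \<in> param_box k r. 1 < card (adjacent_cells k r x)}"

definition polynomial_on_cells ::
    "('l::finite \<Rightarrow> nat) \<Rightarrow> ('l \<Rightarrow> nat \<Rightarrow> real) \<Rightarrow> (real^'l \<Rightarrow> 'b::real_normed_vector) \<Rightarrow> bool" where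
  "polynomial_on_cells k r f \<longleftrightarrow>
    (\<forall>c \<in> cell_indices k. \<exists>p. polynomial_function p \<and> (\<forall>x \<in> cell r c. f x = p x))"

text \<open>The partial derivative along coordinate \<open>s\<close> of a function on \<open>P\<close>. It is the ordinary one at
  interior points of \<open>P\<close>; at a point on the boundary of the box \<open>P\<close> only increments staying in
  \<open>P\<close> count, so that it is one-sided whenever the coordinate line leaves \<open>P\<close> there. See
  \<open>jacobian_in_eq_matrix_extension\<close> below for the agreement with the derivative of an extension
  of the restriction to a cell.\<close>

definition partial_deriv_in ::
    "(real^'l::finite) set \<Rightarrow> (real^'l \<Rightarrow> real) \<Rightarrow> 'l \<Rightarrow> real^'l \<Rightarrow> real" where
  "partial_deriv_in P f s x =
    vector_derivative (\<lambda>t. f (x + t *\<^sub>R axis s 1)) (at 0 within {t. x + t *\<^sub>R axis s 1 \<in> P})"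

definition jacobian_in ::
    "(real^'l::finite) set \<Rightarrow> (real^'l \<Rightarrow> real^'q::finite) \<Rightarrow> real^'l \<Rightarrow> real^'l^'q" where
  "jacobian_in P f x = (\<chi> a s. partial_deriv_in P (\<lambda>z. f z $ a) s x)"

text \<open>The limits below are total functions; they exist when the restriction of \<open>f\<close> to each cell
  extends to a \<open>C\<^sup>1\<close> map near that cell, in particular for \<^const>\<open>polynomial_on_cells\<close>.\<close>

definition rel_clarke_jacobian ::
    "('l::finite \<Rightarrow> nat) \<Rightarrow> ('l \<Rightarrow> nat \<Rightarrow> real) \<Rightarrow> (real^'l \<Rightarrow> real^'q::finite) \<Rightarrow> real^'l
      \<Rightarrow> (real^'l^'q) set" where
  "rel_clarke_jacobian k r f x =
    convex hull {Lim (at x within (top_of_set (param_box k r) interior_of cell r c))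
                     (jacobian_in (param_box k r) f) | c. c \<in> adjacent_cells k r x}"

definition limiting_jacobian ::
    "('l::finite \<Rightarrow> nat) \<Rightarrow> ('l \<Rightarrow> nat \<Rightarrow> real) \<Rightarrow> (real^'l \<Rightarrow> real^'q::finite) \<Rightarrow> ('l \<Rightarrow> nat)
      \<Rightarrow> real^'l \<Rightarrow> real^'l^'q" where
  "limiting_jacobian k r f c x =
    (\<chi> i s. Lim (at x within interior (cell r c))
                (partial_deriv_in (param_box k r) (\<lambda>z. f z $ i) s))"

definition symmetric_matrix :: "real^'n^'n::finite \<Rightarrow> bool" where
  "symmetric_matrix A \<longleftrightarrow> transpose A = A"

definition neg_semidef :: "real^'n^'n::finite \<Rightarrow> bool" where
  "neg_semidef A \<longleftrightarrow> symmetric_matrix A \<and> (\<forall>v. v \<bullet> (A *v v) \<le> 0)"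

lemma jacobian_in_eq_matrix_extension:
  fixes f g :: "real^'l::finite \<Rightarrow> real^'q::finite"
  assumes grid: "grid k r"
    and x: "x \<in> top_of_set (param_box k r) interior_of cell r c"
    and eq: "\<And>z. z \<in> cell r c \<Longrightarrow> f z = g z"
    and g: "(g has_derivative g') (at x)"
  shows "jacobian_in (param_box k r) f x = matrix g'"
proof -
  define P where "P = param_box k r"
  obtain U where U: "open U" "x \<in> U" "U \<inter> P \<subseteq> cell r c" and xP: "x \<in> P"
    using x unfolding interior_of_def P_def[symmetric] by (auto simp: openin_open)
  have "partial_deriv_in P (\<lambda>z. f z $ a) s x = matrix g' $ a $ s" for a s
  proof -
    define S where "S = {t. x + t *\<^sub>R axis s 1 \<in> P}"
    let ?h = "\<lambda>t. x + t *\<^sub>R (axis s 1 :: real^'l)"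
    have hs: "?h t $ j = (if j = s then x $ s + t else x $ j)" for t j
      by (auto simp: axis_def)
    have xb: "r j 1 \<le> x $ j" "x $ j \<le> r j (k j)" for j
      using xP by (auto simp: P_def param_box_def mem_box_cart)
    have "t \<in> S \<longleftrightarrow> t \<in> {r s 1 - x $ s .. r s (k s) - x $ s}" for t
    proof -
      have "t \<in> S \<longleftrightarrow> (\<forall>j. r j 1 \<le> ?h t $ j \<and> ?h t $ j \<le> r j (k j))"
        unfolding S_def P_def param_box_def by (simp only: mem_Collect_eq mem_box_cart vec_lambda_beta)
      also have "\<dots> \<longleftrightarrow> r s 1 \<le> x $ s + t \<and> x $ s + t \<le> r s (k s)"
        unfolding hs using xb by auto
      finally show ?thesis by auto
    qed
    then have S: "S = {r s 1 - x $ s .. r s (k s) - x $ s}" by blast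
    have lt: "r s 1 < r s (k s)"
      using grid unfolding grid_def strict_mono_on_def
      by (metis Suc_1 Suc_le_lessD atLeastAtMost_iff le_refl less_imp_le)
    have nb: "at 0 within S \<noteq> bot"
      unfolding S using lt xb[of s] by (subst trivial_limit_within, subst islimpt_Icc) auto
    have h0: "(?h has_derivative (\<lambda>t. t *\<^sub>R axis s 1)) (at 0 within S)"
      by (auto intro!: derivative_eq_intros)
    have g0: "(g has_derivative g') (at (?h 0) within ?h ` S)"
      using g by (simp add: has_derivative_at_withinI)
    have "((g \<circ> ?h) has_derivative (g' \<circ> (\<lambda>t. t *\<^sub>R axis s 1))) (at 0 within S)"
      by (rule diff_chain_within[OF h0 g0])
    then have "((\<lambda>t. g (?h t)) has_vector_derivative g' (axis s 1)) (at 0 within S)"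
      using linear_scale[OF has_derivative_linear[OF g]]
      by (simp add: has_vector_derivative_def o_def)
    then have gd: "((\<lambda>t. g (?h t) $ a) has_vector_derivative g' (axis s 1) $ a) (at 0 within S)"
      by (rule bounded_linear.has_vector_derivative[OF bounded_linear_vec_nth])
    obtain e where e: "e > 0" "\<And>z. dist z x < e \<Longrightarrow> z \<in> U"
      using U(1,2) unfolding open_dist by blast
    have ev: "g (?h t) $ a = f (?h t) $ a" if "t \<in> S" "dist t 0 < e" for t
    proof -
      have "?h t \<in> U \<inter> P"
        using that e(2)[of "?h t"] by (simp add: S_def dist_norm)
      then show ?thesis
        using U(3) eq by auto
    qed
    have "0 \<in> S"
      using xP by (simp add: S_def)
    have "((\<lambda>t. f (?h t) $ a) has_vector_derivative g' (axis s 1) $ a) (at 0 within S)"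
      by (rule has_vector_derivative_transform_within[OF gd e(1) \<open>0 \<in> S\<close> ev])
    then have "vector_derivative (\<lambda>t. f (?h t) $ a) (at 0 within S) = g' (axis s 1) $ a"
      by (rule vector_derivative_within[OF nb])
    then show ?thesis
      by (simp add: partial_deriv_in_def S_def matrix_def)
  qed
  then show ?thesis
    by (simp add: jacobian_in_def P_def vec_eq_iff)
qed

end

theory Submission
  imports Defs
begin

text \<open>On each adjacent cell \<open>y\<close> coincides with a polynomial map. Its Jacobian is continuous and agrees
  with the (one-sided) Jacobian of \<open>y\<close> on the relative interior of the cell, so the limits through
  the interior and through the relative interior are both the Jacobian of that polynomial at the
  point; the generators of the two convex hulls are therefore the same matrices. The matrix
  inequality is affine in \<open>G\<close> and the negative semidefinite matrices form a convex set, so it passes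
  from the generators to their convex hull.\<close>

section \<open>Continuous differentiability of polynomial maps\<close>

text \<open>Induction along the generation of polynomials by linear maps, constants, sums and
  products. Continuity of the derivative is stated for each fixed direction \<open>h\<close>: this
  avoids the operator norm and suffices for Jacobian entries, which are its values at axis
  vectors.\<close>

lemma real_polynomial_function_C1:
  fixes p :: "'a::real_normed_vector \<Rightarrow> real"
  assumes "real_polynomial_function p"
  shows "\<exists>p'. (\<forall>x. (p has_derivative p' x) (at x)) \<and> (\<forall>h. continuous_on UNIV (\<lambda>x. p' x h))"
  using assms
proof (induction rule: real_polynomial_function.induct)
  case (linear f)
  then show ?case
    by (intro exI[of _ "\<lambda>_. f"]) (auto intro: bounded_linear_imp_has_derivative)
next
  case (const c)
  show ?case
    by (intro exI[of _ "\<lambda>_ _. 0"]) auto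
next
  case (add f g)
  then obtain f' g' where
    "\<And>x. (f has_derivative f' x) (at x)" "\<And>h. continuous_on UNIV (\<lambda>x. f' x h)"
    "\<And>x. (g has_derivative g' x) (at x)" "\<And>h. continuous_on UNIV (\<lambda>x. g' x h)"
    by blast
  then show ?case
    by (intro exI[of _ "\<lambda>x h. f' x h + g' x h"])
      (auto intro!: has_derivative_add continuous_on_add)
next
  case (mult f g)
  then obtain f' g' where d:
    "\<And>x. (f has_derivative f' x) (at x)" "\<And>h. continuous_on UNIV (\<lambda>x. f' x h)"
    "\<And>x. (g has_derivative g' x) (at x)" "\<And>h. continuous_on UNIV (\<lambda>x. g' x h)"
    by blast
  \<comment> \<open>The product rule brings the values of \<open>f\<close> and \<open>g\<close> into
    the derivative, so their continuity is needed as well.\<close>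
  have "continuous_on UNIV f" "continuous_on UNIV g"
    using d(1,3) by (auto intro: has_derivative_continuous_on)
  with d show ?case
    by (intro exI[of _ "\<lambda>x h. f x * g' x h + f' x h * g x"])
      (auto intro!: has_derivative_mult continuous_intros)
qed

text \<open>The derivative is assembled from those of the components; its continuity is phrased
  through \<open>matrix\<close>, the form in which Jacobians are compared later.\<close>

lemma polynomial_function_C1:
  fixes p :: "real^'l::finite \<Rightarrow> real^'q::finite"
  assumes "polynomial_function p"
  obtains p' where "\<And>x. (p has_derivative p' x) (at x)"
    "continuous_on UNIV (\<lambda>x. matrix (p' x))"
proof -
  have "real_polynomial_function (\<lambda>x. p x $ a)" for a
    using assms bounded_linear_vec_nth[of a] unfolding polynomial_function_def o_def by blast
  then have "\<forall>a. \<exists>p'. (\<forall>x. ((\<lambda>x. p x $ a) has_derivative p' x) (at x))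
      \<and> (\<forall>h. continuous_on UNIV (\<lambda>x. p' x h))"
    using real_polynomial_function_C1 by blast
  then obtain D where D: "\<And>a x. ((\<lambda>x. p x $ a) has_derivative D a x) (at x)"
    and cont: "\<And>a h. continuous_on UNIV (\<lambda>x. D a x h)"
    by metis
  have "(p has_derivative (\<lambda>h. \<chi> a. D a x h)) (at x)" for x
  proof (subst has_derivative_componentwise_within, rule ballI)
    fix i :: "real^'q"
    assume "i \<in> Basis"
    then obtain a where "i = axis a 1"
      by (auto simp: Basis_vec_def)
    then show "((\<lambda>x. p x \<bullet> i) has_derivative (\<lambda>h. (\<chi> a. D a x h) \<bullet> i)) (at x)"
      using D[of a x] by (simp add: inner_axis)
  qed
  moreover have "continuous_on UNIV (\<lambda>x. matrix (\<lambda>h. \<chi> a. D a x h))"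
    unfolding matrix_def by (simp add: continuous_on_vec_lambda cont)
  ultimately show thesis
    by (rule that)
qed

section \<open>Geometry of the grid cells\<close>

lemma cell_subset_param_box:
  assumes "grid k r" "c \<in> cell_indices k"
  shows "cell r c \<subseteq> param_box k r"
proof -
  have mono: "r s i \<le> r s j" if "i \<le> j" "i \<in> {1..k s}" "j \<in> {1..k s}" for s i j
    using assms(1) that unfolding grid_def by (metis strict_mono_on_leD)
  have c: "1 \<le> c s" "c s + 1 \<le> k s" for s
    using assms unfolding cell_indices_def grid_def by (fastforce dest: spec[of _ s])+
  have "r s 1 \<le> r s (c s)" "r s (c s + 1) \<le> r s (k s)" for s
    using c[of s] by (auto intro!: mono)
  then show ?thesis
    unfolding cell_def param_box_def by (intro subset_interval_imp_cart) simp
qed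

lemma cell_interior_nonempty:
  assumes "grid k r" "c \<in> cell_indices k"
  shows "interior (cell r c) \<noteq> {}"
proof -
  have c: "1 \<le> c s" "c s + 1 \<le> k s" for s
    using assms unfolding cell_indices_def grid_def by (fastforce dest: spec[of _ s])+
  have "r s (c s) < r s (c s + 1)" for s
    using assms(1) c[of s] unfolding grid_def strict_mono_on_def by auto
  then show ?thesis
    unfolding cell_def interior_cbox by (simp add: interval_ne_empty_cart)
qed

text \<open>\<open>Lim\<close> is pinned down by convergence only along a nontrivial filter. A cell
  is a closed convex set with nonempty interior, hence the closure of its interior.\<close>

lemma at_within_cell_interior_nontrivial:
  assumes "grid k r" "c \<in> cell_indices k" "x \<in> cell r c"
  shows "at x within interior (cell r c) \<noteq> bot"
proof -
  have "convex (cell r c)" "closed (cell r c)"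
    by (simp_all add: cell_def convex_box closed_cbox)
  then have cl: "x \<in> closure (interior (cell r c))"
    using convex_closure_interior[of "cell r c"] cell_interior_nonempty[OF assms(1,2)] assms(3)
    by simp
  have "x islimpt interior (cell r c)"
  \<comment> \<open>Closure alone does not give a limit point when \<open>x\<close> lies in the set
    itself; there openness excludes an isolated point.\<close>
  proof (cases "x \<in> interior (cell r c)")
    case True
    then show ?thesis
      using interior_limit_point[of x "interior (cell r c)"] by simp
  next
    case False
    then show ?thesis
      using cl by (auto simp: closure_def)
  qed
  then show ?thesis
    by (simp add: trivial_limit_within)
qed

lemma interior_cell_subset_rel_interior:
  assumes "grid k r" "c \<in> cell_indices k"
  shows "interior (cell r c) \<subseteq> top_of_set (param_box k r) interior_of cell r c"
proof (rule interior_of_maximal[OF interior_subset])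
  show "openin (top_of_set (param_box k r)) (interior (cell r c))"
    using cell_subset_param_box[OF assms] interior_subset[of "cell r c"]
    by (intro open_subset) auto
qed

section \<open>Identification of the limiting Jacobians\<close>

text \<open>Both sides equal \<open>matrix (p' x)\<close>, where \<open>p\<close> is the polynomial
  map representing \<open>f\<close> on the cell.\<close>

lemma limiting_jacobians_agree:
  assumes grid: "grid k r"
    and poly: "polynomial_on_cells k r f"
    and c: "c \<in> adjacent_cells k r x"
  shows "Lim (at x within (top_of_set (param_box k r) interior_of cell r c))
           (jacobian_in (param_box k r) f) = limiting_jacobian k r f c x"
proof -
  define P where "P = param_box k r"
  define W where "W = top_of_set P interior_of cell r c"
  have ci: "c \<in> cell_indices k" and x: "x \<in> cell r c"
    using c by (auto simp: adjacent_cells_def)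
  obtain p where p: "polynomial_function p" "\<And>z. z \<in> cell r c \<Longrightarrow> f z = p z"
    using poly ci unfolding polynomial_on_cells_def by blast
  obtain p' where p': "\<And>z. (p has_derivative p' z) (at z)"
    and cont: "continuous_on UNIV (\<lambda>z. matrix (p' z))"
    using polynomial_function_C1[OF p(1)] by blast
  have jac: "matrix (p' z) = jacobian_in P f z" if "z \<in> W" for z
    using jacobian_in_eq_matrix_extension[OF grid that[unfolded W_def P_def] p(2) p']
    by (simp add: P_def)
  have "((\<lambda>z. matrix (p' z)) \<longlongrightarrow> matrix (p' x)) (at x within W)"
    using cont by (auto simp: continuous_on_def intro: tendsto_within_subset)
  moreover have "\<forall>\<^sub>F z in at x within W. matrix (p' z) = jacobian_in P f z"
    using jac by (auto simp: eventually_at_filter)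
  ultimately have W: "(jacobian_in P f \<longlongrightarrow> matrix (p' x)) (at x within W)"
    by (rule Lim_transform_eventually)
  have sub: "interior (cell r c) \<subseteq> W"
    unfolding W_def P_def by (rule interior_cell_subset_rel_interior[OF grid ci])
  have nb: "at x within interior (cell r c) \<noteq> bot"
    by (rule at_within_cell_interior_nontrivial[OF grid ci x])
  have "at x within W \<noteq> bot"
    \<comment> \<open>The filter within the smaller set lies below the one within \<open>W\<close>,
      so nontriviality passes upwards.\<close>
    using nb at_le[OF sub, of x] by (metis bot.extremum_uniqueI)
  then have "Lim (at x within W) (jacobian_in P f) = matrix (p' x)"
    using W by (intro tendsto_Lim)
  \<comment> \<open>\<open>limiting_jacobian\<close> takes its limits entry by entry, so the matrix
    limit along \<open>W\<close> is restricted to the interior and read off componentwise.\<close>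
  moreover have "Lim (at x within interior (cell r c)) (partial_deriv_in P (\<lambda>z. f z $ i) s)
      = matrix (p' x) $ i $ s" for i s
  proof (rule tendsto_Lim[OF nb])
    have "((\<lambda>z. jacobian_in P f z $ i $ s) \<longlongrightarrow> matrix (p' x) $ i $ s)
        (at x within interior (cell r c))"
      by (intro tendsto_vec_nth tendsto_within_subset[OF W sub])
    then show "(partial_deriv_in P (\<lambda>z. f z $ i) s \<longlongrightarrow> matrix (p' x) $ i $ s)
        (at x within interior (cell r c))"
      by (simp add: jacobian_in_def)
  qed
  then have "limiting_jacobian k r f c x = matrix (p' x)"
    by (simp add: limiting_jacobian_def P_def vec_eq_iff)
  ultimately show ?thesis
    by (simp add: W_def P_def)
qed

lemma rel_clarke_jacobian_eq:
  assumes "grid k r" "polynomial_on_cells k r f"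
  shows "rel_clarke_jacobian k r f x
    = convex hull {limiting_jacobian k r f c x | c. c \<in> adjacent_cells k r x}"
proof -
  have "{Lim (at x within (top_of_set (param_box k r) interior_of cell r c))
           (jacobian_in (param_box k r) f) | c. c \<in> adjacent_cells k r x}
      = {limiting_jacobian k r f c x | c. c \<in> adjacent_cells k r x}"
    unfolding setcompr_eq_image Collect_mem_eq
    by (intro image_cong refl limiting_jacobians_agree assms)
  then show ?thesis
    by (simp add: rel_clarke_jacobian_def)
qed

section \<open>Passing the matrix inequality to convex hulls\<close>

lemma convex_neg_semidef: "convex {A :: real^'n^'n::finite. neg_semidef A}"
proof (rule convexI)
  fix A B :: "real^'n^'n" and u v :: real
  assume AB: "A \<in> {A. neg_semidef A}" "B \<in> {A. neg_semidef A}" and uv: "0 \<le> u" "0 \<le> v"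
  have "transpose (u *\<^sub>R A + v *\<^sub>R B) = u *\<^sub>R transpose A + v *\<^sub>R transpose B"
    by (simp add: transpose_def vec_eq_iff)
  moreover have "w \<bullet> ((u *\<^sub>R A + v *\<^sub>R B) *v w) \<le> 0" for w
  proof -
    have "w \<bullet> ((u *\<^sub>R A + v *\<^sub>R B) *v w) = u * (w \<bullet> (A *v w)) + v * (w \<bullet> (B *v w))"
      by (simp add: matrix_vector_mult_add_rdistrib scaleR_matrix_vector_assoc[symmetric]
          inner_add_right)
    also have "\<dots> \<le> 0"
      using AB uv by (simp add: neg_semidef_def add_nonpos_nonpos mult_nonneg_nonpos)
    finally show ?thesis .
  qed
  ultimately show "u *\<^sub>R A + v *\<^sub>R B \<in> {A. neg_semidef A}"
    using AB by (simp add: neg_semidef_def symmetric_matrix_def)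
qed

text \<open>A linear map sends the hull of \<open>S\<close> to the hull of its image, and a
  translate of the convex set of negative semidefinite matrices contains that image.
  \<open>C\<close> collects the terms free of \<open>G\<close>.\<close>

lemma neg_semidef_affine_convex_hull:
  fixes T :: "'N::finite \<Rightarrow> 'l::finite \<Rightarrow> real^'n^'n::finite" and S :: "(real^'l^'N) set"
  assumes S: "\<And>G. G \<in> S \<Longrightarrow> neg_semidef ((\<Sum>i\<in>UNIV. \<Sum>s\<in>UNIV. G $ i $ s *\<^sub>R T i s) + C)"
    and G: "G \<in> convex hull S"
  shows "neg_semidef ((\<Sum>i\<in>UNIV. \<Sum>s\<in>UNIV. G $ i $ s *\<^sub>R T i s) + C)"
proof -
  define \<Phi> where "\<Phi> = (\<lambda>G :: real^'l^'N. \<Sum>i\<in>UNIV. \<Sum>s\<in>UNIV. G $ i $ s *\<^sub>R T i s)"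
  have lin: "linear \<Phi>"
    unfolding \<Phi>_def
    by (rule linearI) (simp_all add: scaleR_add_left sum.distrib scaleR_right.sum)
  have "\<Phi> G \<in> convex hull (\<Phi> ` S)"
    using G convex_hull_linear_image[OF lin, of S] by auto
  \<comment> \<open>Translating by \<open>- C\<close> turns the affine condition on
    \<open>\<Phi> H + C\<close> into membership of \<open>\<Phi> H\<close> in a convex set.\<close>
  moreover have "convex hull (\<Phi> ` S) \<subseteq> (\<lambda>A. - C + A) ` {A. neg_semidef A}"
  proof (rule hull_minimal)
    show "\<Phi> ` S \<subseteq> (\<lambda>A. - C + A) ` {A. neg_semidef A}"
    proof clarify
      fix H assume "H \<in> S"
      then show "\<Phi> H \<in> (\<lambda>A. - C + A) ` {A. neg_semidef A}"
        using S[of H] by (intro image_eqI[of _ _ "\<Phi> H + C"]) (auto simp: \<Phi>_def)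
    qed
    show "convex ((\<lambda>A. - C + A) ` {A. neg_semidef A})"
      by (rule convex_translation[OF convex_neg_semidef])
  qed
  ultimately obtain A where "neg_semidef A" "\<Phi> G = - C + A"
    by blast
  then have "neg_semidef (\<Phi> G + C)"
    by simp
  then show ?thesis
    unfolding \<Phi>_def .
qed

theorem lemma2:
  fixes k :: "'l::finite \<Rightarrow> nat"
    and r :: "'l \<Rightarrow> nat \<Rightarrow> real"
    and y :: "real^'l \<Rightarrow> real^'N::finite"
    and T :: "'N \<Rightarrow> 'l \<Rightarrow> real^'l \<Rightarrow> real^'n^'n::finite"
    and F0 :: "real^'l \<Rightarrow> real^'n^'n"
    and F :: "'N \<Rightarrow> real^'l \<Rightarrow> real^'n^'n"
  assumes "grid k r"
    and "\<exists>L. L-lipschitz_on (param_box k r) y"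
    and "polynomial_on_cells k r y"
    and "\<And>i s x. x \<in> param_box k r \<Longrightarrow> symmetric_matrix (T i s x)"
    and "\<And>x. x \<in> param_box k r \<Longrightarrow> symmetric_matrix (F0 x)"
    and "\<And>i x. x \<in> param_box k r \<Longrightarrow> symmetric_matrix (F i x)"
    and "\<And>i s. continuous_on (param_box k r) (T i s)"
    and "continuous_on (param_box k r) F0"
    and "\<And>i. continuous_on (param_box k r) (F i)"
    and "\<And>i s. polynomial_on_cells k r (T i s)"
    and "polynomial_on_cells k r F0"
    and "\<And>i. polynomial_on_cells k r (F i)"
  shows "(\<forall>x \<in> interface_points k r.
            rel_clarke_jacobian k r y x
              \<subseteq> convex hull {limiting_jacobian k r y c x | c. c \<in> adjacent_cells k r x})
       \<and> ((\<forall>x \<in> interface_points k r. \<forall>c \<in> adjacent_cells k r x.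
             neg_semidef ((\<Sum>i\<in>UNIV. \<Sum>s\<in>UNIV. limiting_jacobian k r y c x $ i $ s *\<^sub>R T i s x)
                          + F0 x + (\<Sum>i\<in>UNIV. y x $ i *\<^sub>R F i x)))
          \<longrightarrow> (\<forall>x \<in> interface_points k r. \<forall>G \<in> rel_clarke_jacobian k r y x.
             neg_semidef ((\<Sum>i\<in>UNIV. \<Sum>s\<in>UNIV. G $ i $ s *\<^sub>R T i s x)
                          + F0 x + (\<Sum>i\<in>UNIV. y x $ i *\<^sub>R F i x))))"
proof (intro conjI impI ballI)
  fix x
  show "rel_clarke_jacobian k r y x
      \<subseteq> convex hull {limiting_jacobian k r y c x | c. c \<in> adjacent_cells k r x}"
    using rel_clarke_jacobian_eq[OF assms(1,3)] by blast
next
  fix x G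
  assume *: "\<forall>x \<in> interface_points k r. \<forall>c \<in> adjacent_cells k r x.
      neg_semidef ((\<Sum>i\<in>UNIV. \<Sum>s\<in>UNIV. limiting_jacobian k r y c x $ i $ s *\<^sub>R T i s x)
                   + F0 x + (\<Sum>i\<in>UNIV. y x $ i *\<^sub>R F i x))"
    and x: "x \<in> interface_points k r" and G: "G \<in> rel_clarke_jacobian k r y x"
  show "neg_semidef ((\<Sum>i\<in>UNIV. \<Sum>s\<in>UNIV. G $ i $ s *\<^sub>R T i s x)
                     + F0 x + (\<Sum>i\<in>UNIV. y x $ i *\<^sub>R F i x))"
    \<comment> \<open>Regrouping makes \<open>F0 x\<close> plus the sum over \<open>F i x\<close>
      the constant \<open>C\<close> of the hull lemma.\<close>
    unfolding add.assoc
  proof (rule neg_semidef_affine_convex_hull)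
    show "G \<in> convex hull {limiting_jacobian k r y c x | c. c \<in> adjacent_cells k r x}"
      using G rel_clarke_jacobian_eq[OF assms(1,3)] by blast
  qed (use * x in \<open>auto simp: add.assoc\<close>)
qed

end
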